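(* Let $n\ge2$ and let $P=(p_1,\dots,p_n),\,Q=(q_1,\dots,q_n)\in\Gamma_n$. Then $$\frac18 M_{AH}(P\|Q)\le M_{N_2N_1}(P\|Q)\le\frac13 M_{N_2G}(P\|Q)\le\frac14 M_{AG}(P\|Q)\le M_{AN_2}(P\|Q).$$
   Context: $\Gamma_n=\{(p_1,\dots,p_n): p_i>0,\ \sum_{i=1}^n p_i=1\}$, $n\ge2$. For $a,b>0$ define $$H(a,b)=\frac{2ab}{a+b},\quad G(a,b)=\sqrt{ab},\quad N_1(a,b)=\Big(\frac{\sqrt a+\sqrt b}{2}\Big)^2,\quad N_2(a,b)=\Big(\frac{\sqrt a+\sqrt b}{2}\Big)\sqrt{\frac{a+b}{2}}.$$ For each $M\in\{H,G,N_1,N_2\}$ and $P,Q\in\Gamma_n$ put $M(P\|Q)=\sum_{i=1}^n M(p_i,q_i)$. The mean divergence measures are $$M_{AG}(P\|Q)=1-G(P\|Q),\qquad M_{AH}(P\|Q)=1-H(P\|Q),\qquad M_{AN_2}(P\|Q)=1-N_2(P\|Q),$$ $$M_{N_2G}(P\|Q)=N_2(P\|Q)-G(P\|Q),\qquad M_{N_2N_1}(P\|Q)=N_2(P\|Q)-N_1(P\|Q).$$ *)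

theory Defs
  imports "HOL-Analysis.Analysis"
begin

definition prob_simplex :: "(real ^ 'n) set"
  where "prob_simplex = {p. (\<forall>i. p $ i > 0) \<and> (\<Sum>i\<in>UNIV. p $ i) = 1}"

definition mean_H :: "real \<Rightarrow> real \<Rightarrow> real"
  where "mean_H a b = 2 * a * b / (a + b)"

definition mean_G :: "real \<Rightarrow> real \<Rightarrow> real"
  where "mean_G a b = sqrt (a * b)"

definition mean_N1 :: "real \<Rightarrow> real \<Rightarrow> real"
  where "mean_N1 a b = ((sqrt a + sqrt b) / 2)\<^sup>2"

definition mean_N2 :: "real \<Rightarrow> real \<Rightarrow> real"
  where "mean_N2 a b = ((sqrt a + sqrt b) / 2) * sqrt ((a + b) / 2)"

definition mean_sum :: "(real \<Rightarrow> real \<Rightarrow> real) \<Rightarrow> real ^ 'n \<Rightarrow> real ^ 'n \<Rightarrow> real"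
  where "mean_sum M P Q = (\<Sum>i\<in>UNIV. M (P $ i) (Q $ i))"

text \<open>On the simplex the arithmetic mean (a + b) / 2 of the components sums to 1;
  this is the 1 in the three measures with first index A.\<close>

definition M_AG :: "real ^ 'n \<Rightarrow> real ^ 'n \<Rightarrow> real"
  where "M_AG P Q = 1 - mean_sum mean_G P Q"

definition M_AH :: "real ^ 'n \<Rightarrow> real ^ 'n \<Rightarrow> real"
  where "M_AH P Q = 1 - mean_sum mean_H P Q"

definition M_AN2 :: "real ^ 'n \<Rightarrow> real ^ 'n \<Rightarrow> real"
  where "M_AN2 P Q = 1 - mean_sum mean_N2 P Q"

definition M_N2G :: "real ^ 'n \<Rightarrow> real ^ 'n \<Rightarrow> real"
  where "M_N2G P Q = mean_sum mean_N2 P Q - mean_sum mean_G P Q"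

definition M_N2N1 :: "real ^ 'n \<Rightarrow> real ^ 'n \<Rightarrow> real"
  where "M_N2N1 P Q = mean_sum mean_N2 P Q - mean_sum mean_N1 P Q"

end

(* All the inequalities hold termwise. With s = (sqrt a + sqrt b) / 2 and
   m = sqrt ((a + b) / 2), so that s \<le> m, the means of a and b are
   A = m^2, G = 2 s^2 - m^2, N1 = s^2, N2 = s m and H = G^2 / A. The first
   inequality becomes s (m + s) \<le> 2 m^2, the other three (m - s)^2 \<ge> 0. *)

theory Submission
  imports Defs
begin

text \<open>Common parametrization: in terms of \<open>s\<close> and \<open>m\<close> the five means
  contain no square roots, so each termwise inequality becomes polynomial or rational.\<close>

lemma means_param:
  fixes a b :: real
  assumes "a > 0" and "b > 0"
  obtains s m where "0 < s" "s \<le> m" "(a + b) / 2 = m\<^sup>2" "mean_G a b = 2 * s\<^sup>2 - m\<^sup>2"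
    "mean_N1 a b = s\<^sup>2" "mean_N2 a b = s * m" "mean_H a b = (2 * s\<^sup>2 - m\<^sup>2)\<^sup>2 / m\<^sup>2"
proof -
  define s where "s = (sqrt a + sqrt b) / 2"
  define m where "m = sqrt ((a + b) / 2)"
  have sq: "(sqrt a)\<^sup>2 = a" "(sqrt b)\<^sup>2 = b"
    using assms by auto
  have s: "0 < s"
    using assms by (simp add: s_def add_pos_pos)
  have m: "(a + b) / 2 = m\<^sup>2"
    using assms by (simp add: m_def)
  \<comment> \<open>The right side is 2 m^2 + 2 G, which gives the formula for G.\<close>
  have s2: "4 * s\<^sup>2 = a + b + 2 * (sqrt a * sqrt b)"
    using sq by (simp add: s_def power2_eq_square algebra_simps)
  have G: "mean_G a b = 2 * s\<^sup>2 - m\<^sup>2"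
    unfolding mean_G_def real_sqrt_mult using s2 m by simp
  \<comment> \<open>By AM-GM the cross term in \<open>s2\<close> is at most a + b, hence s^2 \<le>
    m^2.\<close>
  have "0 \<le> (sqrt a - sqrt b)\<^sup>2"
    by simp
  then have "s\<^sup>2 \<le> (a + b) / 2"
    using s2 sq by (simp add: power2_diff)
  then have le: "s \<le> m"
    unfolding m_def by (rule real_le_rsqrt)
  have "mean_H a b = (mean_G a b)\<^sup>2 / ((a + b) / 2)"
    using assms by (simp add: mean_H_def mean_G_def)
  then have H: "mean_H a b = (2 * s\<^sup>2 - m\<^sup>2)\<^sup>2 / m\<^sup>2"
    by (simp only: G m)
  show thesis
    using that[OF s le m G _ _ H] by (simp add: mean_N1_def mean_N2_def s_def m_def)
qed

text \<open>After multiplication by 8 m^2 the left side is m^4 - (2 s^2 - m^2)^2 = 4 s^2 (m^2 -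
  s^2). Both sides then share the factor 4 s (m - s) \<ge> 0, and s (m + s) \<le> 2 m^2
  remains.\<close>

lemma mean_AH_le_N2N1:
  fixes a b :: real
  assumes "a > 0" and "b > 0"
  shows "1 / 8 * ((a + b) / 2 - mean_H a b) \<le> mean_N2 a b - mean_N1 a b"
proof (rule means_param[OF assms])
  fix s m :: real
  assume sm: "0 < s" "s \<le> m" and eqs: "(a + b) / 2 = m\<^sup>2" "mean_N1 a b = s\<^sup>2"
    "mean_N2 a b = s * m" "mean_H a b = (2 * s\<^sup>2 - m\<^sup>2)\<^sup>2 / m\<^sup>2"
  have "s * s \<le> m * m" and "s * m \<le> m * m"
    using sm by (auto intro: mult_mono)
  then have "0 \<le> 2 * m\<^sup>2 - s * (m + s)"
    by (simp add: algebra_simps power2_eq_square)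
  \<comment> \<open>Four times this product is the right side minus the left side of the next
    inequality.\<close>
  then have "0 \<le> s * (m - s) * (2 * m\<^sup>2 - s * (m + s))"
    using sm by simp
  then have "m\<^sup>2 * m\<^sup>2 - (2 * s\<^sup>2 - m\<^sup>2)\<^sup>2 \<le> 8 * (s * m - s\<^sup>2) * m\<^sup>2"
    by (simp add: algebra_simps power2_eq_square)
  moreover have "0 < m\<^sup>2"
    using sm by simp
  ultimately show ?thesis
    unfolding eqs by (simp add: field_simps)
qed

text \<open>The right side exceeds the left by (m - s)^2 / 3.\<close>

lemma mean_N2N1_le_N2G:
  fixes a b :: real
  assumes "a > 0" and "b > 0"
  shows "mean_N2 a b - mean_N1 a b \<le> 1 / 3 * (mean_N2 a b - mean_G a b)"
proof (rule means_param[OF assms])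
  fix s m :: real
  assume eqs: "mean_G a b = 2 * s\<^sup>2 - m\<^sup>2" "mean_N1 a b = s\<^sup>2" "mean_N2 a b = s * m"
  have "0 \<le> (m - s)\<^sup>2"
    by simp
  then show ?thesis
    unfolding eqs by (simp add: power2_diff algebra_simps)
qed

text \<open>Here the gap is (m - s)^2 / 6.\<close>

lemma mean_N2G_le_AG:
  fixes a b :: real
  assumes "a > 0" and "b > 0"
  shows "1 / 3 * (mean_N2 a b - mean_G a b) \<le> 1 / 4 * ((a + b) / 2 - mean_G a b)"
proof (rule means_param[OF assms])
  fix s m :: real
  assume eqs: "(a + b) / 2 = m\<^sup>2" "mean_G a b = 2 * s\<^sup>2 - m\<^sup>2" "mean_N2 a b = s * m"
  have "0 \<le> (m - s)\<^sup>2"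
    by simp
  then show ?thesis
    unfolding eqs by (simp add: power2_diff algebra_simps)
qed

text \<open>Here the gap is (m - s)^2 / 2.\<close>

lemma mean_AG_le_AN2:
  fixes a b :: real
  assumes "a > 0" and "b > 0"
  shows "1 / 4 * ((a + b) / 2 - mean_G a b) \<le> (a + b) / 2 - mean_N2 a b"
proof (rule means_param[OF assms])
  fix s m :: real
  assume eqs: "(a + b) / 2 = m\<^sup>2" "mean_G a b = 2 * s\<^sup>2 - m\<^sup>2" "mean_N2 a b = s * m"
  have "0 \<le> (m - s)\<^sup>2"
    by simp
  then show ?thesis
    unfolding eqs by (simp add: power2_diff algebra_simps)
qed

theorem theorem3:
  fixes P Q :: "real ^ 'n"
  assumes "CARD('n) \<ge> 2"
    and "P \<in> prob_simplex" and "Q \<in> prob_simplex"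
  shows "1 / 8 * M_AH P Q \<le> M_N2N1 P Q
    \<and> M_N2N1 P Q \<le> 1 / 3 * M_N2G P Q
    \<and> 1 / 3 * M_N2G P Q \<le> 1 / 4 * M_AG P Q
    \<and> 1 / 4 * M_AG P Q \<le> M_AN2 P Q"
proof -
  have pos: "P $ i > 0" "Q $ i > 0" for i
    using assms by (auto simp: prob_simplex_def)
  \<comment> \<open>Spreading the constant 1 over the indices as arithmetic means makes termwise
    comparison possible.\<close>
  have one: "1 = (\<Sum>i\<in>UNIV. (P $ i + Q $ i) / 2)"
    using assms by (simp add: prob_simplex_def sum.distrib flip: sum_divide_distrib)
  show ?thesis
    unfolding M_AH_def M_N2N1_def M_N2G_def M_AG_def M_AN2_def mean_sum_def
      \<comment> \<open>Only a 1 from which something is subtracted is to be replaced; the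
        numerators of 1/8, 1/3 and 1/4 must stay.\<close>
      arg_cong[OF one, of "\<lambda>x. x - _"] sum_subtractf[symmetric] sum_distrib_left
    by (intro conjI sum_mono mean_AH_le_N2N1 mean_N2N1_le_N2G mean_N2G_le_AG mean_AG_le_AN2 pos)
qed

end
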